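(* For each positive integer $n$ there exists a function $\rho_n:(0,1)\to(0,1)$ with the following properties: 1) $\rho_n(\varepsilon)<\varepsilon$ for all $\varepsilon\in(0,1)$. 2) For each $0<\varepsilon<1$, each $(y_i)_{i\le n}\in M_{\ell_1}^n$ and each positive integer $n_0\le n$ such that $u^*(y_i)>1-\rho_n(\varepsilon)$ for all $i\le n_0$, there exists $(z_i)_{i\le n}\in M_{\ell_1}^n$ satisfying: a) $\|z_i-y_i\|<\varepsilon$ for all $i\le n$, and b) $z_i\ge 0$ and $u^*(z_i)=1$ for all $i\le n_0$.
   Context: $\ell_1$ is the real Banach space of absolutely summable real sequences with its usual norm and the coordinatewise order ($z\ge0$ means $z(k)\ge 0$ for all $k\in\mathbb{N}$). $u^*$ is the functional on $\ell_1$ given by $u^*(x)=\sum_{k=1}^\infty x(k)$. $M_{\ell_1}^n$ is the set of all $(y_i)_{i\le n}\in(\ell_1)^n$ such that $\bigl\|\sum_{j=1}^k(-1)^{j+1}y_{i_j}\bigr\|\le 1$ for every odd $k\le n$ and all indices $1\le i_1<\dots<i_k\le n$. *)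

theory Defs
  imports "HOL-Analysis.Analysis"
begin

text \<open>The space of absolutely summable real sequences. Sequences are indexed by the
  type \<^typ>\<open>nat\<close>, i.e. starting from 0; this is an immaterial relabelling of the coordinates.\<close>

typedef l1 = "{x :: nat \<Rightarrow> real. summable (\<lambda>k. \<bar>x k\<bar>)}"
  morphisms coord Abs_l1
  by (rule exI[of _ "\<lambda>_. 0"]) simp

setup_lifting type_definition_l1

lemma summable_abs_coord: "summable (\<lambda>k. \<bar>coord x k\<bar>)"
  using coord[of x] by simp

lemma l1_eqI: "(\<And>k. coord x k = coord y k) \<Longrightarrow> x = y"
  by (metis coord_inject ext)

lemma summable_abs_add:
  fixes x y :: "nat \<Rightarrow> real"
  assumes "summable (\<lambda>k. \<bar>x k\<bar>)" "summable (\<lambda>k. \<bar>y k\<bar>)"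
  shows "summable (\<lambda>k. \<bar>x k + y k\<bar>)"
  by (rule summable_comparison_test'[OF summable_add[OF assms], of 0])
     (simp add: abs_triangle_ineq)

lemma summable_abs_diff:
  fixes x y :: "nat \<Rightarrow> real"
  assumes "summable (\<lambda>k. \<bar>x k\<bar>)" "summable (\<lambda>k. \<bar>y k\<bar>)"
  shows "summable (\<lambda>k. \<bar>x k - y k\<bar>)"
  using summable_abs_add[of x "\<lambda>k. - y k"] assms by simp

instantiation l1 :: real_vector
begin

lift_definition zero_l1 :: l1 is "\<lambda>_. 0" by simp

lift_definition plus_l1 :: "l1 \<Rightarrow> l1 \<Rightarrow> l1" is "\<lambda>x y k. x k + y k"
  by (rule summable_abs_add)

lift_definition minus_l1 :: "l1 \<Rightarrow> l1 \<Rightarrow> l1" is "\<lambda>x y k. x k - y k"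
  by (rule summable_abs_diff)

lift_definition uminus_l1 :: "l1 \<Rightarrow> l1" is "\<lambda>x k. - x k" by simp

lift_definition scaleR_l1 :: "real \<Rightarrow> l1 \<Rightarrow> l1" is "\<lambda>r x k. r * x k"
  by (simp add: abs_mult summable_mult)

instance
proof
  fix x y z :: l1 and a b :: real
  show "x + y + z = x + (y + z)" "x + y = y + x" "0 + x = x" "- x + x = 0" "x - y = x + - y"
    by (transfer; simp add: algebra_simps fun_eq_iff)+
  show "a *\<^sub>R (x + y) = a *\<^sub>R x + a *\<^sub>R y" "(a + b) *\<^sub>R x = a *\<^sub>R x + b *\<^sub>R x"
    "a *\<^sub>R b *\<^sub>R x = (a * b) *\<^sub>R x" "1 *\<^sub>R x = x"
    by (transfer; simp add: algebra_simps fun_eq_iff)+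
qed

end

instantiation l1 :: real_normed_vector
begin

lift_definition norm_l1 :: "l1 \<Rightarrow> real" is "\<lambda>x. \<Sum>k. \<bar>x k\<bar>" .

definition sgn_l1 :: "l1 \<Rightarrow> l1" where
  "sgn_l1 x = x /\<^sub>R norm x"

definition dist_l1 :: "l1 \<Rightarrow> l1 \<Rightarrow> real" where
  "dist_l1 x y = norm (x - y)"

definition uniformity_l1 :: "(l1 \<times> l1) filter" where
  "uniformity_l1 = (INF e\<in>{0<..}. principal {(x, y). dist x y < e})"

definition open_l1 :: "l1 set \<Rightarrow> bool" where
  "open_l1 U = (\<forall>x\<in>U. eventually (\<lambda>(x', y). x' = x \<longrightarrow> y \<in> U) uniformity)"

instance
proof
  fix x y :: l1 and a :: real
  show "(norm x = 0) = (x = 0)"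
    by transfer (simp add: suminf_eq_zero_iff fun_eq_iff)
  show "norm (x + y) \<le> norm x + norm y"
  proof transfer
    fix x y :: "nat \<Rightarrow> real"
    assume *: "summable (\<lambda>k. \<bar>x k\<bar>)" "summable (\<lambda>k. \<bar>y k\<bar>)"
    have "(\<Sum>k. \<bar>x k + y k\<bar>) \<le> (\<Sum>k. \<bar>x k\<bar> + \<bar>y k\<bar>)"
      by (intro suminf_le summable_abs_add summable_add * abs_triangle_ineq)
    then show "(\<Sum>k. \<bar>x k + y k\<bar>) \<le> (\<Sum>k. \<bar>x k\<bar>) + (\<Sum>k. \<bar>y k\<bar>)"
      by (simp add: suminf_add *)
  qed
  show "norm (a *\<^sub>R x) = \<bar>a\<bar> * norm x"
    by transfer (simp add: abs_mult suminf_mult)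
qed (simp_all add: sgn_l1_def dist_l1_def uniformity_l1_def open_l1_def)

end

lemma norm_l1_eq: "norm x = (\<Sum>k. \<bar>coord x k\<bar>)"
  by (fact norm_l1.rep_eq)

lemma abs_coord_le_norm: "\<bar>coord x k\<bar> \<le> norm x"
  unfolding norm_l1_eq
  using sum_le_suminf[OF summable_abs_coord, of "{k}" x] by simp

instance l1 :: banach
proof
  fix X :: "nat \<Rightarrow> l1"
  assume X: "Cauchy X"
  have "Cauchy (\<lambda>n. coord (X n) k)" for k
  proof (rule metric_CauchyI)
    fix e :: real
    assume "0 < e"
    then obtain N where N: "\<And>m n. m \<ge> N \<Longrightarrow> n \<ge> N \<Longrightarrow> dist (X m) (X n) < e"
      using metric_CauchyD[OF X] by blast
    have "dist (coord (X m) k) (coord (X n) k) \<le> dist (X m) (X n)" for m n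
      using abs_coord_le_norm[of "X m - X n" k]
      by (simp add: dist_norm minus_l1.rep_eq)
    then show "\<exists>M. \<forall>m\<ge>M. \<forall>n\<ge>M. dist (coord (X m) k) (coord (X n) k) < e"
      using N le_less_trans by blast
  qed
  then have "\<forall>k. \<exists>l. (\<lambda>n. coord (X n) k) \<longlonglongrightarrow> l"
    by (simp add: Cauchy_convergent_iff convergent_def)
  then obtain L where L: "\<And>k. (\<lambda>n. coord (X n) k) \<longlonglongrightarrow> L k"
    by metis
  have close: "\<exists>N. \<forall>m\<ge>N. \<forall>K. (\<Sum>k<K. \<bar>coord (X m) k - L k\<bar>) \<le> e" if e: "0 < e" for e
  proof -
    obtain N where N: "\<And>m n. m \<ge> N \<Longrightarrow> n \<ge> N \<Longrightarrow> dist (X m) (X n) < e"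
      using metric_CauchyD[OF X e] by blast
    have "(\<Sum>k<K. \<bar>coord (X m) k - L k\<bar>) \<le> e" if "m \<ge> N" for m K
    proof (rule LIMSEQ_le_const2)
      show "(\<lambda>n. \<Sum>k<K. \<bar>coord (X m) k - coord (X n) k\<bar>) \<longlonglongrightarrow> (\<Sum>k<K. \<bar>coord (X m) k - L k\<bar>)"
        by (intro tendsto_intros L)
      have "(\<Sum>k<K. \<bar>coord (X m) k - coord (X n) k\<bar>) \<le> e" if "n \<ge> N" for n
      proof -
        have "(\<Sum>k<K. \<bar>coord (X m - X n) k\<bar>) \<le> norm (X m - X n)"
          unfolding norm_l1_eq by (rule sum_le_suminf[OF summable_abs_coord]) auto
        then show ?thesis
          using N[OF \<open>m \<ge> N\<close> that] by (simp add: minus_l1.rep_eq dist_norm)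
      qed
      then show "\<exists>N. \<forall>n\<ge>N. (\<Sum>k<K. \<bar>coord (X m) k - coord (X n) k\<bar>) \<le> e"
        by blast
    qed
    then show ?thesis by blast
  qed
  obtain m0 where m0: "\<And>K. (\<Sum>k<K. \<bar>coord (X m0) k - L k\<bar>) \<le> 1"
    using close[of 1] by auto
  have "summable (\<lambda>k. \<bar>coord (X m0) k - L k\<bar>)"
    by (rule bounded_imp_summable[of _ 1])
       (use m0[of "Suc _"] in \<open>auto simp: lessThan_Suc_atMost\<close>)
  from summable_abs_diff[OF summable_abs_coord[of "X m0"] this]
  have sL: "summable (\<lambda>k. \<bar>L k\<bar>)" by simp
  have cL: "coord (Abs_l1 L) = L"
    using sL by (simp add: Abs_l1_inverse)
  have "X \<longlonglongrightarrow> Abs_l1 L"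
  proof (rule metric_LIMSEQ_I)
    fix r :: real
    assume "0 < r"
    then obtain N where N: "\<And>m K. m \<ge> N \<Longrightarrow> (\<Sum>k<K. \<bar>coord (X m) k - L k\<bar>) \<le> r / 2"
      using close[of "r / 2"] by auto
    have "dist (X m) (Abs_l1 L) \<le> r / 2" if "m \<ge> N" for m
      unfolding dist_norm norm_l1_eq
      by (rule suminf_le_const[OF summable_abs_coord])
         (use N[OF that] in \<open>simp add: minus_l1.rep_eq cL\<close>)
    then show "\<exists>N. \<forall>n\<ge>N. dist (X n) (Abs_l1 L) < r"
      using \<open>0 < r\<close> by (intro exI[of _ N]) (force intro: le_less_trans)
  qed
  then show "convergent X" by (rule convergentI)
qed

instantiation l1 :: ordered_real_vector
begin

lift_definition less_eq_l1 :: "l1 \<Rightarrow> l1 \<Rightarrow> bool" is "\<lambda>x y. \<forall>k. x k \<le> y k" .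

definition less_l1 :: "l1 \<Rightarrow> l1 \<Rightarrow> bool" where
  "less_l1 x y \<longleftrightarrow> x \<le> y \<and> \<not> y \<le> x"

instance
proof
  fix x y z :: l1 and a b :: real
  show "x < y \<longleftrightarrow> x \<le> y \<and> \<not> y \<le> x" by (rule less_l1_def)
  show "x \<le> x" by transfer simp
  show "x \<le> z" if "x \<le> y" "y \<le> z" using that by transfer (blast intro: order_trans)
  show "x = y" if "x \<le> y" "y \<le> x"
    using that by transfer (auto simp: fun_eq_iff intro: antisym)
  show "z + x \<le> z + y" if "x \<le> y" using that by transfer simp
  show "a *\<^sub>R x \<le> a *\<^sub>R y" if "x \<le> y" "0 \<le> a"
    using that by transfer (simp add: mult_left_mono)
  show "a *\<^sub>R x \<le> b *\<^sub>R x" if "a \<le> b" "0 \<le> x"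
    using that by transfer (simp add: mult_right_mono)
qed

end

definition u_star :: "l1 \<Rightarrow> real" where
  "u_star x = (\<Sum>k. coord x k)"

text \<open>An \<open>n\<close>-tuple is an extensional function on \<open>{1..n}\<close>; the indices
  \<open>i\<^sub>1 < \<dots> < i\<^sub>k\<close> are the values of a strictly increasing map \<open>{1..k} \<rightarrow> {1..n}\<close>.\<close>

definition M_l1 :: "nat \<Rightarrow> (nat \<Rightarrow> l1) set" where
  "M_l1 n = {y \<in> {1..n} \<rightarrow>\<^sub>E UNIV.
     \<forall>k i. odd k \<and> k \<le> n \<and> i \<in> {1..k} \<rightarrow> {1..n} \<and> strict_mono_on {1..k} i \<longrightarrow>
       norm (\<Sum>j=1..k. (- 1) ^ (j + 1) *\<^sub>R y (i j)) \<le> 1}"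

end

theory Submission
  imports Defs
begin

text \<open>Every odd alternating sum of the constant family \<open>1\<close> equals \<open>1\<close>. Hence adding to all
  \<open>y\<^sub>i\<close> the same element \<open>\<delta> \<ge> 0\<close>, the sum of the negative parts of all odd alternating sums of
  \<open>y\<^sub>1, \<dots>, y\<^bsub>n\<^sub>0\<^esub>\<close>, makes those alternating sums nonnegative, and \<open>\<parallel>\<delta>\<parallel> = O(\<rho>)\<close> because the
  functional \<open>u\<^sup>*\<close> almost attains its norm at them. After shrinking by \<open>1 - \<eta>\<close>, a multiple of the
  first unit vector is added to each \<open>y\<^sub>i\<close>: it restores \<open>u\<^sup>* = 1\<close> for \<open>i \<le> n\<^sub>0\<close>, while for
  \<open>i > n\<^sub>0\<close> it equals \<open>\<eta> (1 - (i - n\<^sub>0) / n)\<close>. Odd alternating sums of these weights drop by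
  \<open>\<eta> / n\<close> as soon as some index exceeds \<open>n\<^sub>0\<close>, which absorbs the errors of order \<open>\<rho>\<close>.\<close>

section \<open>Alternating sums\<close>

text \<open>The sign of an index is the parity of its rank in \<open>A\<close>, so the least index
  gets a plus. Working with index sets instead of increasing index maps permits induction on the
  largest element.\<close>

definition alt_sum :: "(nat \<Rightarrow> 'a::real_vector) \<Rightarrow> nat set \<Rightarrow> 'a" where
  "alt_sum f A = (\<Sum>a\<in>A. (- 1) ^ card {b\<in>A. b < a} *\<^sub>R f a)"

lemma alt_sum_empty [simp]: "alt_sum f {} = 0"
  by (simp add: alt_sum_def)

lemma alt_sum_cong: "(\<And>a. a \<in> A \<Longrightarrow> f a = g a) \<Longrightarrow> alt_sum f A = alt_sum g A"
  by (simp add: alt_sum_def)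

lemma alt_sum_add: "alt_sum (\<lambda>a. f a + g a) A = alt_sum f A + alt_sum g A"
  by (simp add: alt_sum_def sum.distrib scaleR_add_right)

lemma alt_sum_linear: "linear h \<Longrightarrow> alt_sum (\<lambda>a. h (f a)) A = h (alt_sum f A)"
  by (simp add: alt_sum_def linear_sum linear_cmul)

text \<open>A new largest index leaves all other ranks unchanged, and its own rank is
  \<open>card A\<close>.\<close>

lemma alt_sum_insert_max:
  assumes "finite A" "\<And>b. b \<in> A \<Longrightarrow> b < a"
  shows "alt_sum f (insert a A) = alt_sum f A + (- 1) ^ card A *\<^sub>R f a"
proof -
  have "a \<notin> A" using assms(2) by blast
  moreover have "{b\<in>insert a A. b < a} = A" using assms(2) by auto
  moreover have "{b\<in>insert a A. b < c} = {b\<in>A. b < c}" if "c \<in> A" for c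
    using assms(2)[OF that] by auto
  ultimately show ?thesis
    using assms(1) by (simp add: alt_sum_def add.commute)
qed

lemma alt_sum_singleton [simp]: "alt_sum f {a} = f a"
  using alt_sum_insert_max[of "{}" a f] by simp

lemma abs_alt_sum_le:
  fixes f :: "nat \<Rightarrow> real"
  assumes "A \<subseteq> {1..n}" "\<And>a. a \<in> A \<Longrightarrow> \<bar>f a\<bar> \<le> c" "0 \<le> c"
  shows "\<bar>alt_sum f A\<bar> \<le> real n * c"
proof -
  have "\<bar>alt_sum f A\<bar> \<le> (\<Sum>a\<in>A. \<bar>(- 1) ^ card {b\<in>A. b < a} *\<^sub>R f a\<bar>)"
    unfolding alt_sum_def by (rule sum_abs)
  also have "\<dots> \<le> real (card A) * c"
    by (rule sum_bounded_above) (simp add: abs_mult power_abs assms)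
  also have "\<dots> \<le> real n * c"
    using card_mono[OF _ assms(1)] assms(3) by (simp add: mult_right_mono)
  finally show ?thesis .
qed

text \<open>Adding a largest index flips the parity of \<open>card A\<close>, so each parity feeds
  the other in the induction and both are carried together. The bound \<open>m\<close> is kept
  general so that the induction hypothesis can be used with the newly inserted index, after which
  \<open>f m \<le> f a\<close> finishes.\<close>

lemma alt_sum_antimono_bounds:
  fixes f :: "nat \<Rightarrow> real"
  assumes "antimono f" "\<And>a. f a \<le> 1" "finite A" "\<And>a. a \<in> A \<Longrightarrow> a \<le> m"
  shows "if even (card A) then 0 \<le> alt_sum f A \<and> alt_sum f A \<le> 1 - f m
         else f m \<le> alt_sum f A \<and> alt_sum f A \<le> 1"
  using assms(3,4)
proof (induction A arbitrary: m rule: finite_linorder_max_induct)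
  case empty
  then show ?case using assms(2) by simp
next
  case (insert a A)
  have "a \<notin> A" using insert.hyps(2) by blast
  have "f m \<le> f a"
    using insert.prems assms(1) by (simp add: antimonoD)
  moreover have "if even (card A) then 0 \<le> alt_sum f A \<and> alt_sum f A \<le> 1 - f a
         else f a \<le> alt_sum f A \<and> alt_sum f A \<le> 1"
    using insert.IH[of a] insert.hyps(2) by (simp add: less_imp_le)
  ultimately show ?case
    using insert.hyps \<open>a \<notin> A\<close> by (auto simp: alt_sum_insert_max split: if_splits)
qed

text \<open>For the constant function 1 the lower and upper bounds of the odd case coincide.\<close>

lemma alt_sum_const_one: "odd (card A) \<Longrightarrow> alt_sum (\<lambda>_. 1::real) A = 1"
proof -
  assume "odd (card A)"
  moreover from this have "finite A" by (metis card.infinite even_zero)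
  ultimately show ?thesis
    using alt_sum_antimono_bounds[of "\<lambda>_. 1" A "Max A"] by (simp add: antimono_def)
qed

text \<open>Splitting off the largest index \<open>L > n\<^sub>0\<close> leaves an even sum of at
  most \<open>1 - f (L - 1)\<close>. Adding \<open>f L\<close> gives at most
  \<open>1 - (f (L - 1) - f L)\<close>, and beyond \<open>n\<^sub>0\<close> the ramp descends by
  exactly \<open>1 / n\<close> per step.\<close>

lemma abs_alt_sum_ramp_le:
  assumes A: "A \<subseteq> {1..n}" "odd (card A)" and "\<not> A \<subseteq> {1..n\<^sub>0}"
  shows "\<bar>alt_sum (\<lambda>i. 1 - real (i - n\<^sub>0) / real n) A\<bar> \<le> 1 - 1 / real n"
proof -
  define f where "f = (\<lambda>i. 1 - real (i - n\<^sub>0) / real n)"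
  have f: "antimono f" "f a \<le> 1" for a
    by (auto simp: f_def antimono_def divide_right_mono)
  have fin: "finite A" using A(1) finite_subset by blast
  define L where "L = Max A"
  define B where "B = A - {L}"
  obtain a where a: "a \<in> A" "n\<^sub>0 < a" using assms by force
  have "L \<in> A" unfolding L_def by (rule Max_in) (use fin a in auto)
  moreover have "a \<le> L" unfolding L_def by (rule Max_ge) (use fin a in auto)
  ultimately have L: "L \<in> A" "n\<^sub>0 < L" "L \<le> n"
    using a A(1) by auto
  have B: "finite B" "\<And>b. b \<in> B \<Longrightarrow> b < L" "insert L B = A" "even (card B)"
    using fin L(1) A(2) Max_ge[of A] unfolding B_def L_def
    by (auto simp: order_less_le)
  have "alt_sum f A = alt_sum f B + f L"
    using alt_sum_insert_max[OF B(1,2), of f] B(3,4) by simp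
  \<comment> \<open>The bound is taken at \<open>L - 1\<close> rather than \<open>L\<close>, as all
    of \<open>B\<close> lies strictly below \<open>L\<close>; this yields the gain
    \<open>1 / n\<close>.\<close>
  moreover have "0 \<le> alt_sum f B" "alt_sum f B \<le> 1 - f (L - 1)"
    using alt_sum_antimono_bounds[OF f B(1), of "L - 1"] B(2,4) by fastforce+
  moreover have "f (L - 1) = f L + 1 / real n"
    using L by (simp add: f_def field_simps of_nat_diff)
  moreover have "0 \<le> f L"
    using L by (simp add: f_def)
  moreover have "1 / real n \<le> 1"
    using L by simp
  ultimately show ?thesis
    unfolding f_def[symmetric] by linarith
qed

text \<open>Exactly \<open>i 1, ..., i (j - 1)\<close> lie below \<open>i j\<close> in the image, so
  its rank \<open>j - 1\<close> has the parity of \<open>j + 1\<close>.\<close>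

lemma alt_sum_image_strict_mono:
  assumes "strict_mono_on {1..k} i"
  shows "alt_sum y (i ` {1..k}) = (\<Sum>j=1..k. (- 1) ^ (j + 1) *\<^sub>R y (i j))"
proof -
  have inj: "inj_on i {1..k}"
    using assms by (rule strict_mono_on_imp_inj_on)
  have "card {b \<in> i ` {1..k}. b < i j} = j - 1" if j: "j \<in> {1..k}" for j
  proof -
    have "{b \<in> i ` {1..k}. b < i j} = i ` {1..<j}"
      using j strict_mono_on_less[OF assms] by (auto simp: image_iff)
    moreover have "inj_on i {1..<j}"
      using inj by (rule inj_on_subset) (use j in auto)
    ultimately show ?thesis by (simp add: card_image)
  qed
  moreover have "(- 1 :: real) ^ (j - 1) = (- 1) ^ (j + 1)" if "j \<in> {1..k}" for j
    using that by (cases j) auto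
  ultimately show ?thesis
    unfolding alt_sum_def sum.reindex[OF inj] o_def by (intro sum.cong) (simp_all only:)
qed

text \<open>Increasing maps on \<open>{1..k}\<close> correspond to their \<open>k\<close>-element
  images; the condition \<open>k \<le> n\<close> is automatic for subsets of
  \<open>{1..n}\<close>.\<close>

lemma M_l1_iff:
  "y \<in> M_l1 n \<longleftrightarrow>
    y \<in> extensional {1..n} \<and> (\<forall>A\<subseteq>{1..n}. odd (card A) \<longrightarrow> norm (alt_sum y A) \<le> 1)"
proof (intro iffI conjI allI impI)
  assume y: "y \<in> M_l1 n"
  then show "y \<in> extensional {1..n}" by (simp add: M_l1_def PiE_def)
  fix A :: "nat set" assume A: "A \<subseteq> {1..n}" "odd (card A)"
  then have fin: "finite A" using finite_subset by blast
  then obtain h where h: "bij_betw h {..<card A} A" "strict_mono_on {..<card A} h"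
    using ex_bij_betw_strict_mono_card by blast
  \<comment> \<open>The increasing enumeration \<open>h\<close> of \<open>A\<close> starts at 0,
    whereas \<open>M_l1\<close> counts from 1.\<close>
  define i where "i = (\<lambda>j. h (j - 1))"
  have mono: "strict_mono_on {1..card A} i"
    unfolding i_def by (rule strict_mono_onI, rule strict_mono_onD[OF h(2)]) auto
  have "i ` {1..card A} = h ` {..<card A}"
  proof -
    have "{..<card A} = (\<lambda>j. j - 1) ` {1..card A}"
      by (force simp: image_iff intro: bexI[of _ "Suc _"])
    then show ?thesis by (simp add: i_def image_image)
  qed
  with h(1) have img: "i ` {1..card A} = A" by (simp add: bij_betw_def)
  have "card A \<le> n" using card_mono[OF _ A(1)] by simp
  moreover have "i \<in> {1..card A} \<rightarrow> {1..n}" using img A(1) by blast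
  ultimately have "norm (\<Sum>j=1..card A. (- 1) ^ (j + 1) *\<^sub>R y (i j)) \<le> 1"
    using y A(2) mono unfolding M_l1_def by blast
  then show "norm (alt_sum y A) \<le> 1"
    using alt_sum_image_strict_mono[OF mono, of y] img by simp
next
  assume y: "y \<in> extensional {1..n} \<and> (\<forall>A\<subseteq>{1..n}. odd (card A) \<longrightarrow> norm (alt_sum y A) \<le> 1)"
  have "norm (\<Sum>j=1..k. (- 1) ^ (j + 1) *\<^sub>R y (i j)) \<le> 1"
    if "odd k" "i \<in> {1..k} \<rightarrow> {1..n}" "strict_mono_on {1..k} i" for k i
  proof -
    have "card (i ` {1..k}) = k"
      using card_image[OF strict_mono_on_imp_inj_on[OF that(3)]] by simp
    then have "norm (alt_sum y (i ` {1..k})) \<le> 1"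
      using y that by (metis image_subset_iff_funcset)
    then show ?thesis by (simp only: alt_sum_image_strict_mono[OF that(3)])
  qed
  then show "y \<in> M_l1 n"
    using y by (auto simp: M_l1_def PiE_def)
qed

section \<open>The functional and the negative part\<close>

lemma summable_coord: "summable (coord x)"
  using summable_abs_coord by (rule summable_rabs_cancel)

lemma linear_coord: "linear (\<lambda>x. coord x k)"
  by (rule linearI) (simp_all add: plus_l1.rep_eq scaleR_l1.rep_eq)

lemma linear_u_star: "linear u_star"
  by (rule linearI)
     (simp_all add: u_star_def plus_l1.rep_eq scaleR_l1.rep_eq suminf_add suminf_mult summable_coord)

lemma u_star_le_norm: "u_star x \<le> norm x"
  unfolding u_star_def norm_l1_eq
  by (intro suminf_le summable_coord summable_abs_coord) simp

lemma norm_eq_u_star: "0 \<le> x \<Longrightarrow> norm x = u_star x"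
  by (simp add: u_star_def norm_l1_eq less_eq_l1.rep_eq zero_l1.rep_eq)

lift_definition neg_part :: "l1 \<Rightarrow> l1" is "\<lambda>x k. max 0 (- x k)"
  by (rule summable_comparison_test'[where N = 0]) auto

lemma neg_part_nonneg: "0 \<le> neg_part x"
  by transfer simp

lemma add_neg_part_nonneg: "0 \<le> x + neg_part x"
  by transfer auto

text \<open>Coordinatewise, twice the negative part of \<open>t\<close> is
  \<open>\<bar>t\<bar> - t\<close>. Thus a vector on which \<open>u_star\<close> nearly attains the
  norm has a small negative part.\<close>

lemma norm_neg_part: "2 * norm (neg_part x) = norm x - u_star x"
proof -
  have "norm (neg_part x) = (\<Sum>k. (\<bar>coord x k\<bar> - coord x k) / 2)"
    unfolding norm_l1_eq neg_part.rep_eq by (rule suminf_cong) (simp add: max_def)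
  also have "\<dots> = (norm x - u_star x) / 2"
    unfolding norm_l1_eq u_star_def
    by (simp add: suminf_diff suminf_divide summable_diff summable_abs_coord summable_coord)
  finally show ?thesis by simp
qed

lift_definition first_unit :: l1 is "\<lambda>k. if k = 0 then 1 else 0"
  by (rule summable_finite[of "{0}"]) auto

lemma first_unit_nonneg: "0 \<le> first_unit"
  by transfer simp

lemma u_star_first_unit: "u_star first_unit = 1"
proof -
  have "u_star first_unit = (\<Sum>k\<in>{0}. coord first_unit k)"
    unfolding u_star_def by (rule suminf_finite) (auto simp: first_unit.rep_eq)
  then show ?thesis by (simp add: first_unit.rep_eq)
qed

lemma norm_first_unit: "norm first_unit = 1"
  using norm_eq_u_star[OF first_unit_nonneg] u_star_first_unit by simp

section \<open>The perturbation\<close>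

lemma M_l1_norm_le:
  assumes "y \<in> M_l1 n" "i \<in> {1..n}"
  shows "norm (y i) \<le> 1"
  using assms by (auto simp: M_l1_iff dest: spec[of _ "{i}"])

text \<open>One shift serves all \<open>A\<close> because a sum of nonnegative vectors dominates
  each summand. There are at most \<open>2 ^ n\<close> summands, each of norm at most
  \<open>n * \<rho>\<close>.\<close>

lemma exists_common_positive_shift:
  assumes y: "y \<in> M_l1 n" and "n\<^sub>0 \<le> n" "0 \<le> \<rho>"
    and u: "\<And>i. i \<in> {1..n\<^sub>0} \<Longrightarrow> 1 - \<rho> \<le> u_star (y i)"
  obtains \<delta> where "0 \<le> \<delta>" "norm \<delta> \<le> 2 ^ n * real n * \<rho>"
    "\<And>A. A \<subseteq> {1..n\<^sub>0} \<Longrightarrow> odd (card A) \<Longrightarrow> 0 \<le> alt_sum y A + \<delta>"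
proof
  define F where "F = {A. A \<subseteq> {1..n\<^sub>0} \<and> odd (card A)}"
  define \<delta> where "\<delta> = (\<Sum>A\<in>F. neg_part (alt_sum y A))"
  have F: "F \<subseteq> Pow {1..n\<^sub>0}" by (auto simp: F_def)
  then have finF: "finite F" by (rule finite_subset) simp
  show "0 \<le> \<delta>"
    unfolding \<delta>_def by (rule sum_nonneg) (rule neg_part_nonneg)
  show "0 \<le> alt_sum y A + \<delta>" if "A \<subseteq> {1..n\<^sub>0}" "odd (card A)" for A
  proof -
    have "A \<in> F" using that by (simp add: F_def)
    then have "neg_part (alt_sum y A) \<le> \<delta>"
      unfolding \<delta>_def using sum_mono2[OF finF, of "{A}" "\<lambda>A. neg_part (alt_sum y A)"]
      by (simp add: neg_part_nonneg)
    then show ?thesis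
      using add_neg_part_nonneg[of "alt_sum y A"] by (meson add_left_mono order_trans)
  qed
  have bound: "norm (neg_part (alt_sum y A)) \<le> real n * \<rho>" if "A \<in> F" for A
  proof -
    have A: "A \<subseteq> {1..n}" "A \<subseteq> {1..n\<^sub>0}" "odd (card A)"
      using that \<open>n\<^sub>0 \<le> n\<close> by (auto simp: F_def)
    \<comment> \<open>Writing 1 as \<open>u_star (y i)\<close> plus its defect shows that
      \<open>u_star (alt_sum y A)\<close> misses 1 only by an alternating sum of defects, each in
      \<open>[0, \<rho>]\<close>.\<close>
    have "u_star (alt_sum y A) + alt_sum (\<lambda>i. 1 - u_star (y i)) A =
        alt_sum (\<lambda>i. u_star (y i) + (1 - u_star (y i))) A"
      by (simp only: alt_sum_add alt_sum_linear[OF linear_u_star])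
    also have "\<dots> = 1"
      using alt_sum_const_one[OF A(3)] by simp
    finally have "u_star (alt_sum y A) + alt_sum (\<lambda>i. 1 - u_star (y i)) A = 1" .
    moreover have "\<bar>alt_sum (\<lambda>i. 1 - u_star (y i)) A\<bar> \<le> real n * \<rho>"
    proof (rule abs_alt_sum_le[OF A(1) _ \<open>0 \<le> \<rho>\<close>])
      fix a assume "a \<in> A"
      then have "u_star (y a) \<le> 1" "1 - \<rho> \<le> u_star (y a)"
        using A u M_l1_norm_le[OF y, of a] u_star_le_norm[of "y a"] by auto
      then show "\<bar>1 - u_star (y a)\<bar> \<le> \<rho>" by linarith
    qed
    moreover have "norm (alt_sum y A) \<le> 1"
      using y A by (simp add: M_l1_iff)
    moreover have "0 \<le> real n * \<rho>" using \<open>0 \<le> \<rho>\<close> by simp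
    ultimately show ?thesis using norm_neg_part[of "alt_sum y A"] by linarith
  qed
  have "norm \<delta> \<le> real (card F) * (real n * \<rho>)"
    unfolding \<delta>_def by (rule order_trans[OF norm_sum sum_bounded_above]) (rule bound)
  also have "\<dots> \<le> 2 ^ n * (real n * \<rho>)"
  proof (rule mult_right_mono)
    have "card F \<le> 2 ^ n\<^sub>0"
      using card_mono[OF _ F] by (simp add: card_Pow)
    also have "\<dots> \<le> 2 ^ n" using \<open>n\<^sub>0 \<le> n\<close> by simp
    finally show "real (card F) \<le> 2 ^ n" by simp
  qed (use \<open>0 \<le> \<rho>\<close> in simp)
  finally show "norm \<delta> \<le> 2 ^ n * real n * \<rho>" by (simp add: mult.assoc)
qed

text \<open>The lower bound on \<open>\<eta>\<close> ensures that one ramp step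
  \<open>\<eta> / n\<close> pays for the error \<open>n * E\<close> from the corrections
  \<open>r\<close> and \<open>E\<close> from the shift, where \<open>E\<close> bounds
  \<open>norm \<delta> + \<rho>\<close>.\<close>

lemma perturb_M_l1:
  assumes y: "y \<in> M_l1 n" and n: "n\<^sub>0 \<in> {1..n}" and \<rho>: "0 \<le> \<rho>" and \<eta>: "\<eta> \<le> 1"
    and u: "\<And>i. i \<in> {1..n\<^sub>0} \<Longrightarrow> 1 - \<rho> \<le> u_star (y i)"
    and \<eta>_ge: "real n * real (n + 1) * ((2 ^ n * real n + 1) * \<rho>) \<le> \<eta>"
  obtains z where "z \<in> M_l1 n" "\<And>i. i \<in> {1..n} \<Longrightarrow> norm (z i - y i) \<le> 4 * \<eta>"
    "\<And>i. i \<in> {1..n\<^sub>0} \<Longrightarrow> 0 \<le> z i \<and> u_star (z i) = 1"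
proof -
  obtain \<delta> where \<delta>: "0 \<le> \<delta>" "norm \<delta> \<le> 2 ^ n * real n * \<rho>"
    "\<And>A. A \<subseteq> {1..n\<^sub>0} \<Longrightarrow> odd (card A) \<Longrightarrow> 0 \<le> alt_sum y A + \<delta>"
    using exists_common_positive_shift[OF y _ \<rho> u] n by auto
  define E where "E = (2 ^ n * real n + 1) * \<rho>"
  have E: "norm \<delta> + \<rho> \<le> E" "0 \<le> E" using \<delta>(2) \<rho> by (simp_all add: E_def algebra_simps)
  have n1: "1 \<le> real n" using n by simp
  have \<eta>E: "real n * (real n * E + E) \<le> \<eta>"
    using \<eta>_ge by (simp add: E_def algebra_simps)
  moreover have "real n * E + E \<le> real n * (real n * E + E)" "E \<le> real n * E"
    using n1 E(2) mult_right_mono[OF n1, of "real n * E + E"] mult_right_mono[OF n1, of E] by auto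
  ultimately have \<eta>E': "real n * E + E \<le> \<eta>" "E \<le> \<eta>" "0 \<le> \<eta>" "real n * E \<le> \<eta>"
    using E(2) by linarith+
  have \<eta>n: "real n * E + E \<le> \<eta> / real n"
    using \<eta>E n1 by (simp add: field_simps)
  \<comment> \<open>Truncated subtraction makes the weight equal to 1 for all
    \<open>i \<le> n\<^sub>0\<close>.\<close>
  define w where "w i = 1 - real (i - n\<^sub>0) / real n" for i
  \<comment> \<open>For \<open>i \<le> n\<^sub>0\<close> this is the solution of
    \<open>u_star (x i) = 1\<close>; beyond \<open>n\<^sub>0\<close> no value of
    \<open>u_star\<close> is prescribed.\<close>
  define r where
    "r i = (if i \<le> n\<^sub>0 then (1 - \<eta>) * (1 - u_star (y i) - u_star \<delta>) else 0)" for i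
  define x where "x i = (1 - \<eta>) *\<^sub>R (y i + \<delta>) + (\<eta> * w i + r i) *\<^sub>R first_unit" for i
  define z where "z = restrict x {1..n}"
  have r: "\<bar>r i\<bar> \<le> E" if "i \<in> {1..n}" for i
  proof (cases "i \<le> n\<^sub>0")
    case True
    have "u_star (y i) \<le> 1" "1 - \<rho> \<le> u_star (y i)"
      using u[of i] that True M_l1_norm_le[OF y, of i] u_star_le_norm[of "y i"] by auto
    moreover have "u_star \<delta> = norm \<delta>" using norm_eq_u_star[OF \<delta>(1)] by simp
    \<comment> \<open>The defect \<open>1 - u_star (y i)\<close> lies in \<open>[0, \<rho>]\<close>
      and \<open>u_star \<delta>\<close> is \<open>norm \<delta>\<close>, so the difference lies
      between \<open>- norm \<delta>\<close> and \<open>\<rho>\<close>.\<close>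
    ultimately have "\<bar>1 - u_star (y i) - u_star \<delta>\<bar> \<le> E"
      using E \<rho> norm_ge_zero[of \<delta>] by linarith
    then have "\<bar>1 - \<eta>\<bar> * \<bar>1 - u_star (y i) - u_star \<delta>\<bar> \<le> 1 * E"
      using \<eta> \<eta>E'(3) by (intro mult_mono) auto
    then show ?thesis using True by (simp add: r_def abs_mult)
  qed (use E in \<open>simp add: r_def\<close>)
  have alt_x: "alt_sum x A = (1 - \<eta>) *\<^sub>R (alt_sum y A + \<delta>)
      + (\<eta> * alt_sum w A + alt_sum r A) *\<^sub>R first_unit" if "odd (card A)" for A
  proof -
    \<comment> \<open>The constant family is the image of the constant 1 under the linear map
      sending \<open>t\<close> to \<open>t *\<^sub>R \<delta>\<close>, so an odd alternating sum
      returns \<open>\<delta>\<close> itself.\<close>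
    have "alt_sum (\<lambda>_. \<delta>) A = alt_sum (\<lambda>_. 1 *\<^sub>R \<delta>) A" by simp
    also have "\<dots> = alt_sum (\<lambda>_. 1::real) A *\<^sub>R \<delta>"
      by (rule alt_sum_linear) (rule linearI; simp add: scaleR_add_left)
    finally have \<delta>_eq: "alt_sum (\<lambda>_. \<delta>) A = \<delta>"
      using alt_sum_const_one[OF that] by simp
    have lin1: "linear (\<lambda>v::l1. (1 - \<eta>) *\<^sub>R v)"
      and lin2: "linear (\<lambda>t. t *\<^sub>R first_unit)" and lin3: "linear (\<lambda>t. \<eta> * t)"
      by (rule linearI; simp add: algebra_simps)+
    show ?thesis
      unfolding x_def
      by (simp only: alt_sum_add alt_sum_linear[OF lin1] alt_sum_linear[OF lin2]
          alt_sum_linear[OF lin3] \<delta>_eq)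
  qed
  have u_x: "u_star (x i) = 1" if "i \<in> {1..n\<^sub>0}" for i
  proof -
    have "w i = 1" using that by (simp add: w_def)
    then have "u_star (x i) = (1 - \<eta>) * (u_star (y i) + u_star \<delta>) + (\<eta> + r i)"
      by (simp add: x_def linear_add[OF linear_u_star] linear_cmul[OF linear_u_star] u_star_first_unit)
    also have "\<dots> = 1" using that by (simp add: r_def algebra_simps)
    finally show ?thesis .
  qed
  have nonneg: "0 \<le> alt_sum x A" if A: "A \<subseteq> {1..n\<^sub>0}" "odd (card A)" for A
  proof -
    have "alt_sum w A = alt_sum (\<lambda>_. 1) A"
      using A by (intro alt_sum_cong) (auto simp: w_def)
    then have "alt_sum w A = 1" using alt_sum_const_one[OF A(2)] by simp
    moreover have "\<bar>alt_sum r A\<bar> \<le> real n * E"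
      using A n by (intro abs_alt_sum_le r E) auto
    \<comment> \<open>The coefficient of \<open>first_unit\<close> is at least
      \<open>\<eta> - n * E\<close>.\<close>
    ultimately have "0 \<le> \<eta> * alt_sum w A + alt_sum r A"
      using \<eta>E' by auto
    then show ?thesis
      unfolding alt_x[OF A(2)] using \<delta>(3)[OF A] \<eta> first_unit_nonneg
      by (intro add_nonneg_nonneg[OF scaleR_nonneg_nonneg scaleR_nonneg_nonneg]) auto
  qed
  have norm_x: "norm (alt_sum x A) \<le> 1" if A: "A \<subseteq> {1..n}" "odd (card A)" for A
  proof (cases "A \<subseteq> {1..n\<^sub>0}")
    case True
    \<comment> \<open>For nonnegative vectors the norm is \<open>u_star\<close>, here an odd
      alternating sum of ones.\<close>
    have "u_star (alt_sum x A) = alt_sum (\<lambda>i. u_star (x i)) A"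
      by (simp only: alt_sum_linear[OF linear_u_star])
    also have "\<dots> = alt_sum (\<lambda>_. 1) A"
      using True u_x by (intro alt_sum_cong) auto
    finally show ?thesis
      using norm_eq_u_star[OF nonneg[OF True A(2)]] alt_sum_const_one[OF A(2)] by simp
  next
    case False
    have "\<bar>alt_sum w A\<bar> \<le> 1 - 1 / real n"
      unfolding w_def by (rule abs_alt_sum_ramp_le[OF A False])
    then have "\<bar>\<eta> * alt_sum w A\<bar> \<le> \<eta> * (1 - 1 / real n)"
      using \<eta>E'(3) by (simp add: abs_mult mult_left_mono)
    moreover have "\<bar>alt_sum r A\<bar> \<le> real n * E"
      using A by (intro abs_alt_sum_le r E) auto
    ultimately have e: "\<bar>\<eta> * alt_sum w A + alt_sum r A\<bar> \<le> \<eta> * (1 - 1 / real n) + real n * E"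
      by linarith
    have "norm (alt_sum y A + \<delta>) \<le> 1 + E"
      using norm_triangle_ineq[of "alt_sum y A" \<delta>] y A E \<rho> by (auto simp: M_l1_iff)
    then have "(1 - \<eta>) * norm (alt_sum y A + \<delta>) \<le> (1 - \<eta>) * (1 + E)"
      using \<eta> by (intro mult_left_mono) auto
    also have "\<dots> \<le> 1 - \<eta> + E"
      using \<eta>E'(3) E(2) by (simp add: algebra_simps)
    \<comment> \<open>The two occurrences of \<open>\<eta>\<close> cancel, leaving
      \<open>1 + (n * E + E) - \<eta> / n\<close>.\<close>
    finally have "norm (alt_sum x A) \<le> (1 - \<eta> + E) + (\<eta> * (1 - 1 / real n) + real n * E)"
      unfolding alt_x[OF A(2)] using \<eta> e
      by (intro norm_triangle_le) (simp add: norm_first_unit)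
    also have "\<dots> \<le> 1" using \<eta>n by (simp add: algebra_simps)
    finally show ?thesis .
  qed
  have "norm (x i - y i) \<le> 4 * \<eta>" if "i \<in> {1..n}" for i
  proof -
    have "x i - y i = (1 - \<eta>) *\<^sub>R \<delta> - \<eta> *\<^sub>R y i + (\<eta> * w i + r i) *\<^sub>R first_unit"
      by (simp add: x_def algebra_simps)
    then have "norm (x i - y i) \<le> norm ((1 - \<eta>) *\<^sub>R \<delta>) + norm (\<eta> *\<^sub>R y i)
        + norm ((\<eta> * w i + r i) *\<^sub>R first_unit)"
      by (metis norm_triangle_ineq norm_triangle_ineq4 norm_triangle_mono order_refl)
    moreover have "norm ((1 - \<eta>) *\<^sub>R \<delta>) \<le> E"
      using E \<rho> \<eta> \<eta>E'(3) mult_left_le_one_le[of "norm \<delta>" "1 - \<eta>"] by simp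
    moreover have "norm (\<eta> *\<^sub>R y i) \<le> \<eta>"
      using M_l1_norm_le[OF y that] \<eta>E'(3) mult_left_mono[of "norm (y i)" 1 \<eta>] by simp
    moreover have "norm ((\<eta> * w i + r i) *\<^sub>R first_unit) \<le> \<eta> + E"
    proof -
      have "real (i - n\<^sub>0) / real n \<le> 1" using that by auto
      then have "\<bar>w i\<bar> \<le> 1" by (simp add: w_def abs_le_iff)
      then have "\<bar>\<eta> * w i\<bar> \<le> \<eta>"
        using \<eta>E'(3) mult_left_mono[of "\<bar>w i\<bar>" 1 \<eta>] by (simp add: abs_mult)
      then show ?thesis using r[OF that] by (simp add: norm_first_unit)
    qed
    \<comment> \<open>The three contributions add up to \<open>2 * \<eta> + 2 * E\<close>, and
      \<open>E \<le> \<eta>\<close>.\<close>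
    ultimately show ?thesis using \<eta>E'(2) by linarith
  qed
  moreover have "z \<in> M_l1 n"
  proof -
    have "alt_sum z A = alt_sum x A" if "A \<subseteq> {1..n}" for A
      using that by (intro alt_sum_cong) (auto simp: z_def)
    then show ?thesis using norm_x by (simp add: M_l1_iff z_def)
  qed
  \<comment> \<open>Positivity of a single entry is the case of a singleton index set.\<close>
  moreover have "0 \<le> x i \<and> u_star (x i) = 1" if "i \<in> {1..n\<^sub>0}" for i
    using nonneg[of "{i}"] u_x that by simp
  ultimately show ?thesis
    using that[of z] n by (simp add: z_def)
qed

theorem theorem4p2:
  fixes n :: nat
  assumes "n \<ge> 1"
  shows "\<exists>\<rho> :: real \<Rightarrow> real.
    \<rho> \<in> {0<..<1} \<rightarrow> {0<..<1} \<and>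
    (\<forall>\<epsilon>\<in>{0<..<1}. \<rho> \<epsilon> < \<epsilon>) \<and>
    (\<forall>\<epsilon>\<in>{0<..<1}. \<forall>y\<in>M_l1 n. \<forall>n\<^sub>0\<in>{1..n}.
       (\<forall>i\<in>{1..n\<^sub>0}. u_star (y i) > 1 - \<rho> \<epsilon>) \<longrightarrow>
       (\<exists>z\<in>M_l1 n.
          (\<forall>i\<in>{1..n}. norm (z i - y i) < \<epsilon>) \<and>
          (\<forall>i\<in>{1..n\<^sub>0}. z i \<ge> 0 \<and> u_star (z i) = 1)))"
proof -
  \<comment> \<open>With \<open>\<eta> = \<epsilon> / 5\<close> and
    \<open>\<rho> \<epsilon> = \<epsilon> / c\<close> the requirement on \<open>\<eta>\<close> holds
    with equality; the factor 5 makes \<open>4 * \<eta>\<close> strictly smaller than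
    \<open>\<epsilon>\<close>.\<close>
  define c where "c = 5 * (real n * real (n + 1) * (2 ^ n * real n + 1))"
  have "1 \<le> real n * real (n + 1) * (2 ^ n * real n + 1)"
    using assms mult_mono[of 1 "real n * real (n + 1)" 1 "2 ^ n * real n + 1"]
      mult_mono[of 1 "real n" 1 "real (n + 1)"] by simp
  then have c: "1 < c" by (simp add: c_def)
  define \<rho> where "\<rho> \<epsilon> = \<epsilon> / c" for \<epsilon> :: real
  have \<rho>: "0 < \<rho> \<epsilon>" "\<rho> \<epsilon> < \<epsilon>" if "0 < \<epsilon>" for \<epsilon>
    using that c by (simp_all add: \<rho>_def field_simps)
  have "\<exists>z\<in>M_l1 n. (\<forall>i\<in>{1..n}. norm (z i - y i) < \<epsilon>) \<and>
          (\<forall>i\<in>{1..n\<^sub>0}. z i \<ge> 0 \<and> u_star (z i) = 1)"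
    if \<epsilon>: "\<epsilon> \<in> {0<..<1}" and y: "y \<in> M_l1 n" and n\<^sub>0: "n\<^sub>0 \<in> {1..n}"
      and u: "\<forall>i\<in>{1..n\<^sub>0}. u_star (y i) > 1 - \<rho> \<epsilon>" for \<epsilon> y n\<^sub>0
  proof -
    have "real n * real (n + 1) * ((2 ^ n * real n + 1) * \<rho> \<epsilon>) = c / 5 * \<rho> \<epsilon>"
      by (simp add: c_def)
    also have "\<dots> = \<epsilon> / 5" using c by (simp add: \<rho>_def)
    finally have "real n * real (n + 1) * ((2 ^ n * real n + 1) * \<rho> \<epsilon>) \<le> \<epsilon> / 5" by simp
    moreover have "0 \<le> \<rho> \<epsilon>" "\<epsilon> / 5 \<le> 1" using \<rho>[of \<epsilon>] \<epsilon> by auto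
    ultimately obtain z where z: "z \<in> M_l1 n"
      "\<And>i. i \<in> {1..n} \<Longrightarrow> norm (z i - y i) \<le> 4 * (\<epsilon> / 5)"
      "\<And>i. i \<in> {1..n\<^sub>0} \<Longrightarrow> 0 \<le> z i \<and> u_star (z i) = 1"
      using perturb_M_l1[OF y n\<^sub>0, of "\<rho> \<epsilon>" "\<epsilon> / 5"] u by (metis less_imp_le)
    have "4 * (\<epsilon> / 5) < \<epsilon>" using \<epsilon> by simp
    with z show ?thesis by (meson le_less_trans)
  qed
  then show ?thesis
    using \<rho> by (intro exI[of _ \<rho>]) (force simp: Pi_iff)
qed

end
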